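(* Let $n\ge1$ and let $V=\mathbb{R}^{n+1}$ with the quadratic form $Q(x)=x_1^2+\dotsb+x_n^2-x_{n+1}^2$. The positive reflection length of an isometry $f\in O_+(V)$ is equal to $\dim\mathrm{Mov}(f)$.
   Context: Let $\beta(u,v)=Q(u+v)-Q(u)-Q(v)$. $O(V)$ is the group of $f\in\mathrm{GL}(V)$ with $Q(f(u))=Q(u)$ for all $u$. The moved space of $f$ is $\mathrm{Mov}(f)=\mathrm{im}(\mathrm{id}-f)$. The Wall form of $f$ is the non-degenerate bilinear form $\chi_f$ on $\mathrm{Mov}(f)$ given by $\chi_f(u,v)=\beta(w,v)$, where $w\in V$ is any vector with $u=w-f(w)$. $f$ is positive if the determinant of the matrix of $\chi_f$ in a basis of $\mathrm{Mov}(f)$ is positive (i.e. its spinor norm is positive; the identity is positive), and $O_+(V)$ is the subgroup of $O(V)$ of positive isometries. A positive reflection is $r_v(u)=u-\frac{\beta(u,v)}{Q(v)}v$ with $Q(v)>0$. The positive reflection length of $f$ is the minimal $k$ such that $f$ is a product of $k$ positive reflections ($0$ for the identity). *)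

theory Defs
  imports "Jordan_Normal_Form.Determinant" "HOL-Analysis.Analysis" "HOL-Library.Extended_Nat"
begin

no_notation vec_index (infixl \<open>$\<close> 100)

(* In everything that depends on Q, the parameter is meant to be a quadratic form. *)

definition polar_form :: "('a::real_vector \<Rightarrow> real) \<Rightarrow> 'a \<Rightarrow> 'a \<Rightarrow> real" where
  "polar_form Q u v = Q (u + v) - Q u - Q v"

definition orthogonal_group :: "('a::real_vector \<Rightarrow> real) \<Rightarrow> ('a \<Rightarrow> 'a) set" where
  "orthogonal_group Q = {f. linear f \<and> bij f \<and> (\<forall>u. Q (f u) = Q u)}"

definition Mov :: "('a::real_vector \<Rightarrow> 'a) \<Rightarrow> 'a set" where
  "Mov f = range (\<lambda>w. w - f w)"

(* Only meaningful for u, v in Mov f; the choice of w is then irrelevant, see wall_form_eq. *)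
definition wall_form :: "('a::real_vector \<Rightarrow> real) \<Rightarrow> ('a \<Rightarrow> 'a) \<Rightarrow> 'a \<Rightarrow> 'a \<Rightarrow> real" where
  "wall_form Q f u v = polar_form Q (SOME w. u = w - f w) v"

lemma wall_form_eq:
  assumes bil: "bilinear (polar_form Q)" and f: "f \<in> orthogonal_group Q"
    and v: "v \<in> Mov f"
  shows "wall_form Q f (w - f w) v = polar_form Q w v"
proof -
  define w' where "w' = (SOME x. w - f w = x - f x)"
  have w': "w - f w = w' - f w'"
    unfolding w'_def by (rule someI[where x = w]) (rule refl)
  obtain x where x: "v = x - f x"
    using v by (auto simp: Mov_def)
  have lin: "linear f" and iso: "\<And>u. Q (f u) = Q u"
    using f by (auto simp: orthogonal_group_def)
  define d where "d = w - w'"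
  have fd: "f d = d"
    using w' by (simp add: d_def linear_diff[OF lin] algebra_simps)
  have "polar_form Q d (f x) = polar_form Q (f d) (f x)"
    by (simp add: fd)
  also have "\<dots> = polar_form Q d x"
    by (simp add: polar_form_def iso flip: linear_add[OF lin])
  finally have "polar_form Q d v = 0"
    by (simp add: x bilinear_rsub[OF bil])
  then show ?thesis
    by (simp add: wall_form_def d_def bilinear_lsub[OF bil] flip: w'_def)
qed

definition is_basis_of :: "'a::real_vector list \<Rightarrow> 'a set \<Rightarrow> bool" where
  "is_basis_of bs W \<longleftrightarrow> distinct bs \<and> independent (set bs) \<and> span (set bs) = W"

definition wall_matrix ::
  "('a::real_vector \<Rightarrow> real) \<Rightarrow> ('a \<Rightarrow> 'a) \<Rightarrow> 'a list \<Rightarrow> real Matrix.mat" where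
  "wall_matrix Q f bs =
     Matrix.mat (length bs) (length bs) (\<lambda>(i, j). wall_form Q f (bs ! i) (bs ! j))"

(* A change of basis multiplies the determinant by a nonzero square, so it does not matter
   which basis is used. *)
definition positive_isometry :: "('a::real_vector \<Rightarrow> real) \<Rightarrow> ('a \<Rightarrow> 'a) \<Rightarrow> bool" where
  "positive_isometry Q f \<longleftrightarrow>
     (\<exists>bs. is_basis_of bs (Mov f) \<and> Determinant.det (wall_matrix Q f bs) > 0)"

lemma positive_isometry_id: "positive_isometry Q id"
proof -
  have "is_basis_of [] (Mov id)"
    by (auto simp: is_basis_of_def Mov_def independent_empty)
  moreover have "Determinant.det (wall_matrix Q id []) > 0"
    by (simp add: wall_matrix_def)
  ultimately show ?thesis
    unfolding positive_isometry_def by blast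
qed

definition positive_orthogonal_group :: "('a::real_vector \<Rightarrow> real) \<Rightarrow> ('a \<Rightarrow> 'a) set" where
  "positive_orthogonal_group Q = {f \<in> orthogonal_group Q. positive_isometry Q f}"

definition quadric_reflection :: "('a::real_vector \<Rightarrow> real) \<Rightarrow> 'a \<Rightarrow> 'a \<Rightarrow> 'a" where
  "quadric_reflection Q v u = u - (polar_form Q u v / Q v) *\<^sub>R v"

definition positive_reflections :: "('a::real_vector \<Rightarrow> real) \<Rightarrow> ('a \<Rightarrow> 'a) set" where
  "positive_reflections Q = {quadric_reflection Q v | v. Q v > 0}"

(* The infimum is infinity exactly when f is not a product of positive reflections. *)
definition positive_reflection_length :: "('a::real_vector \<Rightarrow> real) \<Rightarrow> ('a \<Rightarrow> 'a) \<Rightarrow> enat" where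
  "positive_reflection_length Q f =
     (INF rs \<in> {rs. set rs \<subseteq> positive_reflections Q \<and> f = foldr (\<circ>) rs id}. enat (length rs))"

(* The space R^(n+1), n = CARD('n) >= 1, is real^('n option): the indices Some i are the first n
   coordinates and None is the last one. *)
definition lorentz_form :: "real ^ ('n::finite option) \<Rightarrow> real" where
  "lorentz_form x = (\<Sum>i\<in>UNIV. (x $ Some i)\<^sup>2) - (x $ None)\<^sup>2"

end

theory Submission
  imports Defs
begin

text \<open>
  Since \<open>\<chi>\<^sub>f(u,u) = Q(u)\<close>, a vector \<open>v\<close> of \<open>Mov f\<close> with \<open>Q(v) > 0\<close> can be split off: the moved space
  of \<open>r\<^sub>v \<circ> f\<close> is the right orthogonal complement of \<open>v\<close> in \<open>Mov f\<close> with respect to \<open>\<chi>\<^sub>f\<close>, its Wall form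
  is the restriction of \<open>\<chi>\<^sub>f\<close>, and the determinant of \<open>\<chi>\<^sub>f\<close> is divided by \<open>Q(v)\<close>. So \<open>r\<^sub>v \<circ> f\<close> is again
  positive, with a moved space of one dimension less. In Lorentzian signature a subspace without
  positive vectors is at most a line, and a positive isometry whose moved space is a line moves
  along a positive vector; hence the process only stops at the identity.
\<close>

section \<open>Bases of subspaces as lists\<close>

lemma is_basis_of_exists:
  fixes W :: "'a::euclidean_space set"
  assumes "subspace W"
  obtains bs where "is_basis_of bs W"
proof -
  obtain B where B: "B \<subseteq> W" "independent B" "W \<subseteq> span B"
    using maximal_independent_subset by blast
  have "finite B"
    using B(2) by (rule independent_imp_finite)
  then obtain bs where bs: "set bs = B" "distinct bs"
    using finite_distinct_list by blast
  have "span B = W"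
    using B assms by (simp add: span_minimal subset_antisym)
  then have "is_basis_of bs W"
    using bs B(2) by (simp add: is_basis_of_def)
  then show thesis
    by (rule that)
qed

lemma is_basis_of_length:
  assumes "is_basis_of bs (W :: 'a::euclidean_space set)"
  shows "length bs = dim W"
  using assms unfolding is_basis_of_def
  by (metis dim_span_eq_card_independent distinct_card)

lemma span_list_coefficients:
  assumes "distinct bs" "x \<in> span (set bs)"
  obtains a where "x = (\<Sum>i<length bs. a i *\<^sub>R bs ! i)"
proof -
  obtain u where "x = (\<Sum>v\<in>set bs. u v *\<^sub>R v)"
    using assms(2) by (auto simp: span_finite)
  also have "\<dots> = (\<Sum>i<length bs. u (bs ! i) *\<^sub>R bs ! i)"
    using bij_betw_nth[OF assms(1) refl refl]
    by (rule sum.reindex_bij_betw[symmetric])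
  finally show thesis
    by (rule that)
qed

section \<open>Quadratic forms, their isometries and reflections\<close>

locale quadratic_form =
  fixes Q :: "'a::real_vector \<Rightarrow> real"
  assumes bilinear_polar: "bilinear (polar_form Q)"
    and polar_self: "polar_form Q v v = 2 * Q v"
begin

abbreviation \<beta> where "\<beta> \<equiv> polar_form Q"

lemma polar_linear_simps:
  "\<beta> (x + y) z = \<beta> x z + \<beta> y z" "\<beta> (x - y) z = \<beta> x z - \<beta> y z" "\<beta> (c *\<^sub>R x) z = c * \<beta> x z"
  "\<beta> z (x + y) = \<beta> z x + \<beta> z y" "\<beta> z (x - y) = \<beta> z x - \<beta> z y" "\<beta> z (c *\<^sub>R x) = c * \<beta> z x"
  using bilinear_polar
  by (simp_all add: bilinear_ladd bilinear_radd bilinear_lsub bilinear_rsub bilinear_lmul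
      bilinear_rmul)

lemma polar_commute: "\<beta> x y = \<beta> y x"
  by (simp add: polar_form_def add.commute)

lemma form_diff: "Q (x - y) = Q x + Q y - \<beta> x y"
proof -
  have "2 * Q (x - y) = 2 * Q x - 2 * \<beta> x y + 2 * Q y"
    by (simp add: polar_linear_simps polar_commute[of y x] flip: polar_self)
  then show ?thesis
    by simp
qed

text \<open>Homogeneity is assumed in the locale only through \<open>polar_self\<close>, which
  amounts to \<open>Q (v + v) = 4 * Q v\<close>; bilinearity of \<open>\<beta>\<close> then yields
  every real factor.\<close>

lemma form_scale: "Q (c *\<^sub>R x) = c\<^sup>2 * Q x"
proof -
  have "2 * Q (c *\<^sub>R x) = 2 * (c\<^sup>2 * Q x)"
    using polar_self[of "c *\<^sub>R x"] polar_self[of x]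
    by (simp add: polar_linear_simps power2_eq_square)
  then show ?thesis
    by simp
qed

lemma orthogonal_groupD:
  assumes "f \<in> orthogonal_group Q"
  shows "linear f" "Q (f x) = Q x" "\<beta> (f x) (f y) = \<beta> x y"
  using assms by (auto simp: orthogonal_group_def polar_form_def simp flip: linear_add)

lemma orthogonal_group_comp:
  assumes "f \<in> orthogonal_group Q" "g \<in> orthogonal_group Q"
  shows "f \<circ> g \<in> orthogonal_group Q"
  using assms by (auto simp: orthogonal_group_def linear_compose bij_comp)

lemma quadric_reflection_involution:
  assumes "Q v \<noteq> 0"
  shows "quadric_reflection Q v \<circ> quadric_reflection Q v = id"
  using assms
  by (auto simp: fun_eq_iff quadric_reflection_def polar_linear_simps polar_self field_simps
      scaleR_left.diff simp flip: scaleR_left_distrib)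

lemma quadric_reflection_orthogonal:
  assumes "Q v \<noteq> 0"
  shows "quadric_reflection Q v \<in> orthogonal_group Q"
proof -
  have "linear (quadric_reflection Q v)"
    by (rule linearI)
      (simp_all add: quadric_reflection_def polar_linear_simps add_divide_distrib algebra_simps)
  moreover have "bij (quadric_reflection Q v)"
    using quadric_reflection_involution[OF assms] by (auto intro: o_bij)
  moreover have "Q (quadric_reflection Q v u) = Q u" for u
    using assms
    by (simp add: quadric_reflection_def form_diff form_scale polar_linear_simps power2_eq_square)
  ultimately show ?thesis
    by (simp add: orthogonal_group_def)
qed

section \<open>Moved space and Wall form\<close>

lemma subspace_Mov:
  assumes "linear f"
  shows "subspace (Mov f)"
  unfolding Mov_def
  by (intro linear_subspace_image linear_compose_sub linear_ident assms subspace_UNIV)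

lemma wall_form_eq_polar:
  assumes "f \<in> orthogonal_group Q" "v \<in> Mov f" "u = w - f w"
  shows "wall_form Q f u v = \<beta> w v"
  using assms wall_form_eq[OF bilinear_polar] by blast

text \<open>Since \<open>f\<close> preserves \<open>Q\<close>, expanding \<open>Q (w - f w)\<close>
  gives \<open>2 * Q w - \<beta> w (f w)\<close>, which is
  \<open>\<beta> w (w - f w)\<close>.\<close>

lemma wall_form_self:
  assumes f: "f \<in> orthogonal_group Q" and u: "u \<in> Mov f"
  shows "wall_form Q f u u = Q u"
proof -
  obtain w where w: "u = w - f w"
    using u by (auto simp: Mov_def)
  have "wall_form Q f u u = \<beta> w u"
    using f u w by (rule wall_form_eq_polar)
  also have "\<dots> = Q u"
    by (simp add: w form_diff polar_linear_simps polar_self orthogonal_groupD[OF f])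
  finally show ?thesis .
qed

text \<open>Bilinearity of the Wall form on the moved space, in the shape needed for a change of
  basis. If each \<open>w i\<close> is a preimage of \<open>u i\<close> under \<open>id - f\<close>,
  then the same linear combination of the \<open>w i\<close> is a preimage of the combination of the
  \<open>u i\<close>.\<close>

lemma wall_form_sums:
  assumes f: "f \<in> orthogonal_group Q" and I: "finite I" "finite J"
    and u: "\<And>i. i \<in> I \<Longrightarrow> u i \<in> Mov f" and v: "\<And>j. j \<in> J \<Longrightarrow> v j \<in> Mov f"
  shows "wall_form Q f (\<Sum>i\<in>I. a i *\<^sub>R u i) (\<Sum>j\<in>J. b j *\<^sub>R v j) =
    (\<Sum>i\<in>I. \<Sum>j\<in>J. a i * b j * wall_form Q f (u i) (v j))"
proof -
  note lin = orthogonal_groupD(1)[OF f]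
  have "\<exists>w. \<forall>i\<in>I. u i = w i - f (w i)"
    using u by (intro bchoice) (auto simp: Mov_def)
  then obtain w where w: "\<And>i. i \<in> I \<Longrightarrow> u i = w i - f (w i)"
    by blast
  have "(\<Sum>i\<in>I. a i *\<^sub>R u i) = (\<Sum>i\<in>I. a i *\<^sub>R w i) - f (\<Sum>i\<in>I. a i *\<^sub>R w i)"
    by (simp add: w linear_sum[OF lin] linear_cmul[OF lin] scaleR_diff_right sum_subtractf)
  moreover have "(\<Sum>j\<in>J. b j *\<^sub>R v j) \<in> Mov f"
    using v by (intro subspace_sum subspace_scale subspace_Mov lin) auto
  ultimately have "wall_form Q f (\<Sum>i\<in>I. a i *\<^sub>R u i) (\<Sum>j\<in>J. b j *\<^sub>R v j) =
      \<beta> (\<Sum>i\<in>I. a i *\<^sub>R w i) (\<Sum>j\<in>J. b j *\<^sub>R v j)"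
    using f by (intro wall_form_eq_polar)
  also have "\<dots> = (\<Sum>i\<in>I. \<Sum>j\<in>J. a i * b j * \<beta> (w i) (v j))"
    using I by (simp add: bilinear_sum[OF bilinear_polar] polar_linear_simps mult_ac
        flip: sum.cartesian_product)
  also have "\<dots> = (\<Sum>i\<in>I. \<Sum>j\<in>J. a i * b j * wall_form Q f (u i) (v j))"
    by (intro sum.cong refl) (simp add: wall_form_eq_polar[OF f v w])
  finally show ?thesis .
qed

end

section \<open>Positive isometries in finite dimension and their factorization\<close>

locale euclidean_quadratic_form = quadratic_form Q for Q :: "'a::euclidean_space \<Rightarrow> real"
begin

text \<open>Passes from the one basis that \<open>positive_isometry\<close> provides to an arbitrary
  one. The two matrices are congruent, so the determinants differ by the factor
  \<open>(det P)\<^sup>2\<close>, and a positive product with a square leaves the other factor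
  positive.\<close>

lemma det_wall_matrix_pos:
  assumes f: "f \<in> orthogonal_group Q" and pos: "positive_isometry Q f"
    and cs: "is_basis_of cs (Mov f)"
  shows "Determinant.det (wall_matrix Q f cs) > 0"
proof -
  obtain bs where bs: "is_basis_of bs (Mov f)" and det: "Determinant.det (wall_matrix Q f bs) > 0"
    using pos by (auto simp: positive_isometry_def)
  define n where "n = length cs"
  have n: "length bs = n"
    using is_basis_of_length[OF bs] is_basis_of_length[OF cs] by (simp add: n_def)
  have csM: "cs ! i \<in> Mov f" if "i < n" for i
    using cs that unfolding is_basis_of_def n_def by (metis nth_mem span_base)
  have "\<exists>a. bs ! i = (\<Sum>k<n. a k *\<^sub>R cs ! k)" if "i < n" for i
  proof -
    have "bs ! i \<in> span (set cs)"
      using bs cs that n unfolding is_basis_of_def by (metis nth_mem span_base)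
    then show ?thesis
      using cs span_list_coefficients unfolding is_basis_of_def n_def by metis
  qed
  then obtain a where a: "\<And>i. i < n \<Longrightarrow> bs ! i = (\<Sum>k<n. a i k *\<^sub>R cs ! k)"
    by metis
  \<comment> \<open>Row \<open>i\<close> of \<open>P\<close> holds the coordinates of
    \<open>bs ! i\<close> with respect to \<open>cs\<close>.\<close>
  define P where "P = Matrix.mat n n (\<lambda>(i, k). a i k)"
  have P: "P \<in> carrier_mat n n"
    by (simp add: P_def)
  have W: "wall_matrix Q f cs \<in> carrier_mat n n"
    by (simp add: wall_matrix_def n_def)
  have "wall_matrix Q f bs = P * wall_matrix Q f cs * transpose_mat P"
  proof (rule eq_matI)
    fix i j
    assume "i < dim_row (P * wall_matrix Q f cs * transpose_mat P)"
      "j < dim_col (P * wall_matrix Q f cs * transpose_mat P)"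
    then have ij: "i < n" "j < n"
      by (simp_all add: P_def)
    have "wall_matrix Q f bs $$ (i, j) =
        wall_form Q f (\<Sum>k<n. a i k *\<^sub>R cs ! k) (\<Sum>l<n. a j l *\<^sub>R cs ! l)"
      using ij by (simp add: wall_matrix_def n a)
    also have "\<dots> = (\<Sum>k<n. \<Sum>l<n. a i k * a j l * wall_form Q f (cs ! k) (cs ! l))"
      using csM by (intro wall_form_sums f) auto
    \<comment> \<open>In the triple product, bracketed to the left, the sum over \<open>l\<close> is
      the outer one.\<close>
    also have "\<dots> = (\<Sum>l<n. \<Sum>k<n. a i k * a j l * wall_form Q f (cs ! k) (cs ! l))"
      by (rule sum.swap)
    also have "\<dots> = (P * wall_matrix Q f cs * transpose_mat P) $$ (i, j)"
      using ij by (simp add: P_def wall_matrix_def scalar_prod_def sum_distrib_left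
          atLeast0LessThan mult_ac flip: n_def)
    finally show "wall_matrix Q f bs $$ (i, j) = (P * wall_matrix Q f cs * transpose_mat P) $$ (i, j)" .
  qed (simp_all add: wall_matrix_def n P_def)
  then have "Determinant.det (wall_matrix Q f bs) =
      (Determinant.det P)\<^sup>2 * Determinant.det (wall_matrix Q f cs)"
    using P W
    by (simp add: Determinant.det_mult[where n = n] Determinant.det_transpose[OF P]
        power2_eq_square)
  then show ?thesis
    using det by (simp add: zero_less_mult_iff)
qed

lemma positive_isometry_split_reflection:
  assumes f: "f \<in> orthogonal_group Q" and pos: "positive_isometry Q f"
    and v: "v \<in> Mov f" "Q v > 0"
  defines "g \<equiv> quadric_reflection Q v \<circ> f"
  shows "g \<in> orthogonal_group Q" "positive_isometry Q g" "dim (Mov f) = Suc (dim (Mov g))"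
proof -
  obtain w where w: "v = w - f w"
    using v by (auto simp: Mov_def)
  note lin = orthogonal_groupD(1)[OF f]
  \<comment> \<open>On \<open>Mov f\<close> the functional \<open>\<beta> w\<close> is the Wall form
    of \<open>f\<close> with left argument \<open>v\<close>.\<close>
  have wv: "\<beta> w v = Q v"
    using wall_form_self[OF f v(1)] wall_form_eq_polar[OF f v(1) w] by simp
  \<comment> \<open>By \<open>wv\<close>, the right side is the projection of \<open>x - f x\<close>
    along \<open>v\<close> onto the kernel of \<open>\<beta> w\<close>.\<close>
  have g_moves: "x - g x = (x - f x) - (\<beta> w (x - f x) / Q v) *\<^sub>R v" for x
  proof -
    have "\<beta> (f x) v = \<beta> (f x) w - \<beta> x w"
      by (simp add: w polar_linear_simps orthogonal_groupD[OF f])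
    also have "\<dots> = - \<beta> w (x - f x)"
      by (simp add: polar_linear_simps polar_commute[of w])
    finally show ?thesis
      by (simp add: g_def quadric_reflection_def)
  qed
  have Mov_g: "Mov g = {u \<in> Mov f. \<beta> w u = 0}"
  proof (intro subset_antisym subsetI)
    fix u assume "u \<in> Mov g"
    then obtain x where "u = x - g x"
      by (auto simp: Mov_def)
    then have u: "u = (x - f x) - (\<beta> w (x - f x) / Q v) *\<^sub>R v"
      by (simp only: g_moves)
    have "x - f x \<in> Mov f"
      by (auto simp: Mov_def)
    then have "u \<in> Mov f"
      unfolding u using v by (metis subspace_diff subspace_scale subspace_Mov lin)
    moreover have "\<beta> w u = 0"
      unfolding u polar_linear_simps(5)[of w "x - f x"] polar_linear_simps(6) wv using v by simp
    ultimately show "u \<in> {u \<in> Mov f. \<beta> w u = 0}"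
      by simp
  next
    fix u assume "u \<in> {u \<in> Mov f. \<beta> w u = 0}"
    then obtain x where "u = x - f x" "\<beta> w (x - f x) = 0"
      by (auto simp: Mov_def)
    then have "u = x - g x"
      by (simp only: g_moves) simp
    then show "u \<in> Mov g"
      by (auto simp: Mov_def)
  qed
  show g: "g \<in> orthogonal_group Q"
    unfolding g_def using f v by (intro orthogonal_group_comp quadric_reflection_orthogonal) auto
  have wall_g: "wall_form Q g u u' = wall_form Q f u u'" if u: "u \<in> Mov g" "u' \<in> Mov g" for u u'
  proof -
    obtain x where x: "u = x - f x" "\<beta> w (x - f x) = 0"
      using u(1) unfolding Mov_g by (auto simp: Mov_def)
    \<comment> \<open>The projection fixes \<open>u\<close>, so one preimage \<open>x\<close>
      computes both Wall forms.\<close>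
    then have xg: "u = x - g x"
      by (simp only: g_moves) simp
    have "u' \<in> Mov f"
      using u(2) by (simp add: Mov_g)
    then show ?thesis
      using wall_form_eq_polar[OF g u(2) xg] wall_form_eq_polar[OF f _ x(1)] by simp
  qed
  obtain cs where cs: "is_basis_of cs (Mov g)"
    using is_basis_of_exists[OF subspace_Mov[OF orthogonal_groupD(1)[OF g]]] .
  then have span_cs: "span (set cs) = Mov g"
    by (simp add: is_basis_of_def)
  have v_notin: "v \<notin> span (set cs)"
    using wv v by (simp add: span_cs Mov_g)
  have vcs: "is_basis_of (v # cs) (Mov f)"
    unfolding is_basis_of_def
  proof (intro conjI)
    show "distinct (v # cs)"
      using cs v_notin span_base by (auto simp: is_basis_of_def)
    show "independent (set (v # cs))"
      using cs v_notin by (simp add: is_basis_of_def independent_insert)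
    show "span (set (v # cs)) = Mov f"
    proof (intro subset_antisym)
      have "set cs \<subseteq> Mov g"
        unfolding span_cs[symmetric] by (rule span_superset)
      then show "span (set (v # cs)) \<subseteq> Mov f"
        using v by (intro span_minimal subspace_Mov lin) (auto simp: Mov_g)
      have "x - f x \<in> span (insert v (set cs))" for x
      proof -
        have "x - f x - (\<beta> w (x - f x) / Q v) *\<^sub>R v \<in> Mov g"
          unfolding g_moves[symmetric] by (auto simp: Mov_def)
        then show ?thesis
          unfolding span_insert span_cs by blast
      qed
      then show "Mov f \<subseteq> span (set (v # cs))"
        by (auto simp: Mov_def)
    qed
  qed
  show "dim (Mov f) = Suc (dim (Mov g))"
    using is_basis_of_length[OF vcs] is_basis_of_length[OF cs] by simp
  let ?n = "length cs"
  have csM: "cs ! i \<in> Mov g" if "i < ?n" for i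
    using that unfolding span_cs[symmetric] by (simp add: span_base)
  \<comment> \<open>The Wall form may fail to be symmetric: \<open>v\<close> is orthogonal to
    \<open>Mov g\<close> as left argument only. Hence the first row of the matrix for
    \<open>v # cs\<close> vanishes off the diagonal, while the column \<open>C\<close> is
    arbitrary.\<close>
  define C where "C = Matrix.mat ?n 1 (\<lambda>(i, j). wall_form Q f (cs ! i) v)"
  have C: "C \<in> carrier_mat ?n 1" and D: "wall_matrix Q g cs \<in> carrier_mat ?n ?n"
    by (simp_all add: C_def wall_matrix_def)
  have A: "Matrix.mat 1 1 (\<lambda>_. Q v) \<in> carrier_mat 1 1"
    by simp
  let ?M = "four_block_mat (Matrix.mat 1 1 (\<lambda>_. Q v)) (0\<^sub>m 1 ?n) C (wall_matrix Q g cs)"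
  have "wall_matrix Q f (v # cs) = ?M"
  proof (rule eq_matI)
    fix i j
    assume "i < dim_row ?M" "j < dim_col ?M"
    then have ij: "i < Suc ?n" "j < Suc ?n"
      using C D by simp_all
    show "wall_matrix Q f (v # cs) $$ (i, j) = ?M $$ (i, j)"
      using ij C D csM wall_form_self[OF f v(1)] wall_form_eq_polar[OF f _ w]
      by (cases i; cases j) (simp_all add: wall_g Mov_g C_def wall_matrix_def)
  qed (use C D in \<open>simp_all add: wall_matrix_def\<close>)
  then have "Determinant.det (wall_matrix Q f (v # cs)) = Q v * Determinant.det (wall_matrix Q g cs)"
    using det_four_block_mat_upper_right_zero[OF A refl C D] by (simp add: det_single)
  then have "Determinant.det (wall_matrix Q g cs) > 0"
    using det_wall_matrix_pos[OF f pos vcs] v by (simp add: zero_less_mult_iff)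
  then show "positive_isometry Q g"
    using cs by (auto simp: positive_isometry_def)
qed

text \<open>The determinant is here the single entry \<open>wall_form Q f v v\<close>, which equals
  \<open>Q v\<close>.\<close>

lemma positive_isometry_dim_one:
  assumes f: "f \<in> orthogonal_group Q" and pos: "positive_isometry Q f" and dim: "dim (Mov f) = 1"
  shows "\<exists>v\<in>Mov f. Q v > 0"
proof -
  obtain bs where bs: "is_basis_of bs (Mov f)" and det: "Determinant.det (wall_matrix Q f bs) > 0"
    using pos by (auto simp: positive_isometry_def)
  then obtain v where v: "bs = [v]"
    using is_basis_of_length[OF bs] dim by (auto simp: length_Suc_conv)
  then have "v \<in> Mov f"
    using bs by (auto simp: is_basis_of_def span_base)
  moreover have "wall_form Q f v v > 0"
    using det by (simp add: v wall_matrix_def det_single)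
  ultimately show ?thesis
    using wall_form_self[OF f] by auto
qed

text \<open>The signature of \<open>Q\<close> enters only through \<open>nonpos\<close>. The bound 1
  is enough because \<open>positive_isometry_dim_one\<close> excludes moved lines without positive
  vectors.\<close>

lemma positive_isometry_factorization:
  assumes nonpos: "\<And>W. subspace W \<Longrightarrow> (\<And>x. x \<in> W \<Longrightarrow> Q x \<le> 0) \<Longrightarrow> dim W \<le> 1"
  assumes "f \<in> orthogonal_group Q" "positive_isometry Q f"
  shows "\<exists>rs. set rs \<subseteq> positive_reflections Q \<and> f = foldr (\<circ>) rs id \<and> length rs = dim (Mov f)"
  using assms(2,3)
proof (induction "dim (Mov f)" arbitrary: f)
  case 0
  then have "Mov f \<subseteq> {0}"
    by (simp add: dim_eq_0)
  then have "x - f x \<in> {0}" for x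
    unfolding Mov_def by blast
  then have "f = id"
    by (simp add: fun_eq_iff)
  then show ?case
    using 0 by (intro exI[of _ "[]"]) simp
next
  case (Suc k)
  note sub = subspace_Mov[OF orthogonal_groupD(1)[OF Suc.prems(1)]]
  have "\<exists>v\<in>Mov f. Q v > 0"
  proof (rule ccontr)
    assume none: "\<not> ?thesis"
    then have "dim (Mov f) \<le> 1"
      by (intro nonpos sub) (auto simp: not_less)
    then have "dim (Mov f) = 1"
      using Suc.hyps(2) by simp
    with none show False
      using positive_isometry_dim_one Suc.prems by blast
  qed
  then obtain v where v: "v \<in> Mov f" "Q v > 0"
    by blast
  let ?r = "quadric_reflection Q v"
  note split = positive_isometry_split_reflection[OF Suc.prems v]
  have "k = dim (Mov (?r \<circ> f))"
    using split(3) Suc.hyps(2) by simp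
  then obtain rs where rs: "set rs \<subseteq> positive_reflections Q" "?r \<circ> f = foldr (\<circ>) rs id"
    "length rs = k"
    using Suc.hyps(1) split(1,2) by metis
  have "f = ?r \<circ> (?r \<circ> f)"
    using quadric_reflection_involution[of v] v by (simp flip: comp_assoc)
  then have "f = foldr (\<circ>) (?r # rs) id"
    using rs(2) by simp
  moreover have "set (?r # rs) \<subseteq> positive_reflections Q"
    using rs(1) v(2) by (auto simp: positive_reflections_def)
  moreover have "length (?r # rs) = dim (Mov f)"
    using rs(3) Suc.hyps(2) by simp
  ultimately show ?case
    by blast
qed

end

section \<open>The lower bound for the length\<close>

lemma dim_Mov_product_le:
  fixes Q :: "'a::euclidean_space \<Rightarrow> real"
  assumes "set rs \<subseteq> positive_reflections Q"
  shows "dim (Mov (foldr (\<circ>) rs id)) \<le> length rs"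
  using assms
proof (induction rs)
  case Nil
  show ?case
    by (auto simp: Mov_def)
next
  case (Cons r rs)
  let ?g = "foldr (\<circ>) rs id"
  obtain v where r: "r = quadric_reflection Q v"
    using Cons.prems by (auto simp: positive_reflections_def)
  \<comment> \<open>A reflection changes its argument by a multiple of \<open>v\<close>, so each
    further factor adds at most one dimension to the moved space.\<close>
  have "x - r (?g x) \<in> span (insert v (Mov ?g))" for x
  proof -
    have "x - r (?g x) = (x - ?g x) + (polar_form Q (?g x) v / Q v) *\<^sub>R v"
      by (simp add: r quadric_reflection_def)
    also have "\<dots> \<in> span (insert v (Mov ?g))"
      by (intro span_add span_scale span_base) (auto simp: Mov_def)
    finally show ?thesis .
  qed
  then have "Mov (foldr (\<circ>) (r # rs) id) \<subseteq> span (insert v (Mov ?g))"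
    by (auto simp: Mov_def)
  then have "dim (Mov (foldr (\<circ>) (r # rs) id)) \<le> dim (insert v (Mov ?g))"
    by (rule dim_subset[THEN order_trans]) simp
  also have "\<dots> \<le> Suc (dim (Mov ?g))"
    by (simp add: dim_insert)
  also have "\<dots> \<le> Suc (length rs)"
  proof -
    have "set rs \<subseteq> positive_reflections Q"
      using Cons.prems by simp
    then show ?thesis
      unfolding Suc_le_mono by (rule Cons.IH)
  qed
  finally show ?case
    by (simp only: list.size add_Suc_right add_0_right)
qed

section \<open>The Lorentz form\<close>

lemma polar_lorentz_form:
  "polar_form lorentz_form x y = 2 * ((\<Sum>i\<in>UNIV. x $ Some i * y $ Some i) - x $ None * y $ None)"
  by (simp add: polar_form_def lorentz_form_def power2_sum sum.distrib sum_distrib_left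
      algebra_simps)

interpretation lorentz: euclidean_quadratic_form "lorentz_form :: real ^ ('n::finite option) \<Rightarrow> real"
proof
  show "bilinear (polar_form (lorentz_form :: real ^ ('n option) \<Rightarrow> real))"
    unfolding bilinear_def
    by (auto intro!: linearI
        simp: polar_lorentz_form sum.distrib sum_distrib_left algebra_simps)
  show "polar_form lorentz_form v v = 2 * lorentz_form v" for v :: "real ^ ('n option)"
    by (simp add: polar_lorentz_form lorentz_form_def power2_eq_square)
qed

text \<open>The form is positive definite on the hyperplane where the last coordinate is 0, so
  \<open>W\<close> meets it only in 0, and the last coordinate embeds \<open>W\<close> into the real
  line.\<close>

lemma dim_lorentz_nonpos_le_1:
  fixes W :: "(real ^ ('n::finite option)) set"
  assumes W: "subspace W" and nonpos: "\<And>x. x \<in> W \<Longrightarrow> lorentz_form x \<le> 0"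
  shows "dim W \<le> 1"
proof -
  let ?t = "\<lambda>x :: real ^ ('n option). x $ None"
  have lin: "linear ?t"
    by (rule linearI) simp_all
  have "x = 0" if "x \<in> W" "?t x = 0" for x
  proof -
    have "(\<Sum>i\<in>UNIV. (x $ Some i)\<^sup>2) \<le> 0"
      using nonpos[OF that(1)] that(2) by (simp add: lorentz_form_def)
    then have "(\<Sum>i\<in>UNIV. (x $ Some i)\<^sup>2) = 0"
      by (simp add: antisym sum_nonneg)
    then have "x $ Some i = 0" for i
      by (simp add: sum_nonneg_eq_0_iff)
    then show ?thesis
      using that(2) by (metis not_None_eq vec_eq_iff zero_index)
  qed
  then have "inj_on ?t W"
    using linear_inj_on_iff_eq_0[OF lin W] by blast
  then have "dim (?t ` W) = dim W"
    using W lin by (intro dim_image_eq) (simp_all add: span_eq_iff[THEN iffD2])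
  then show ?thesis
    using dim_subset_UNIV[of "?t ` W"] by simp
qed

theorem theorem5p2:
  fixes f :: "real ^ ('n::finite option) \<Rightarrow> real ^ ('n option)"
  assumes "f \<in> positive_orthogonal_group lorentz_form"
  shows "positive_reflection_length lorentz_form f = enat (dim (Mov f))"
proof (rule antisym)
  have "f \<in> orthogonal_group lorentz_form" "positive_isometry lorentz_form f"
    using assms by (auto simp: positive_orthogonal_group_def)
  \<comment> \<open>This word is one competitor in the infimum and bounds it from above;
    \<open>dim_Mov_product_le\<close> bounds every competitor from below.\<close>
  then obtain rs where rs: "set rs \<subseteq> positive_reflections lorentz_form" "f = foldr (\<circ>) rs id"
    "length rs = dim (Mov f)"
    using lorentz.positive_isometry_factorization[OF dim_lorentz_nonpos_le_1] by blast
  then show "positive_reflection_length lorentz_form f \<le> enat (dim (Mov f))"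
    unfolding positive_reflection_length_def by (intro INF_lower2[of rs]) auto
  show "enat (dim (Mov f)) \<le> positive_reflection_length lorentz_form f"
    unfolding positive_reflection_length_def
    using dim_Mov_product_le by (intro INF_greatest) auto
qed

end
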